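(* Let $d\ge 1$, $n\ge 0$ and $N_q\ge n$ be integers, let $a>0$ be fixed, and let $(w_{\mathbf i})_{\mathbf i\in\Omega}$, $\Omega\subset\mathbb Z^d$ finite, be invariant weights satisfying the Hermite norm preservation conditions of order $N_q$ with scaling $a$ (see context). Let $f:\mathbb R^d\to\mathbb R$ be a smooth function whose Taylor series about any point converges to $f$ everywhere, let $\mathbf x\in\mathbb R^d$, and let $\mathbf s\in\mathbb Z_{\ge0}^d$ be a multi-index with $|\mathbf s|=n$. Then, as $h\to0^+$, $$\left(\frac ah\right)^n\sum_{\mathbf i\in\Omega}w_{\mathbf i}\,H_{\mathbf s}(a\mathbf i)\,f(\mathbf x+h\mathbf i)=\sum_{m=0}^{N_q-n}\frac{1}{2^m m!}\left(\frac ha\right)^{2m}\Delta^m\partial^{\mathbf s}f(\mathbf x)+O\!\left(h^{2(N_q-n+1)}\right).$$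
   Context: Probabilist's Hermite polynomials: $H_k(x)=(-1)^k e^{x^2/2}\frac{d^k}{dx^k}e^{-x^2/2}$. For a multi-index $\mathbf s=(s_0,\dots,s_{d-1})\in\mathbb Z_{\ge0}^d$ put $|\mathbf s|=\sum_k s_k$, $H_{\mathbf s}(\mathbf x)=\prod_{k=0}^{d-1}H_{s_k}(\mathbf x_k)$, and $\partial^{\mathbf s}=\prod_k\partial^{s_k}/\partial\mathbf x_k^{s_k}$. $\Delta=\sum_k\partial^2/\partial\mathbf x_k^2$ is the Laplacian and $\Delta^m$ its $m$-th power. Let $\omega(x)=\frac1{\sqrt{2\pi}}e^{-x^2/2}$. Weights: $\Omega\subset\mathbb Z^d$ is a finite set and $w_{\mathbf i}\in\mathbb R$ for $\mathbf i\in\Omega$. "Invariant" means that $\Omega$ and $w$ are unchanged under permuting the coordinates of $\mathbf i$ and under changing the sign of any coordinate of $\mathbf i$. The "Hermite norm preservation conditions of order $N_q$ with scaling $a$" are: for every multi-index $\mathbf s$ with $|\mathbf s|\le N_q$, $$\sum_{\mathbf i\in\Omega}w_{\mathbf i}\,H_{\mathbf s}(a\mathbf i)^2=\int_{\mathbb R^d}\prod_{k=0}^{d-1}H_{s_k}(\mathbf x_k)^2\,\omega(\mathbf x_k)\,d\mathbf x .$$ *)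

theory Defs
  imports "HOL-Probability.Probability" "HOL-Library.Landau_Symbols"
begin

text \<open>
  Euclidean \<open>d\<close>-space is \<^typ>\<open>real ^ 'd\<close>, with \<open>d\<close> the cardinality of the index type \<open>'d\<close>, and
  multi-indices have type \<^typ>\<open>nat ^ 'd\<close>. The index type is linearly ordered, like
  \<open>0, \<dots>, d - 1\<close>, only so that the order of differentiation in \<open>mpartial\<close> below is determined;
  on smooth functions that order is irrelevant.
\<close>

definition hermite :: "nat \<Rightarrow> real \<Rightarrow> real" where
  "hermite k x = (-1) ^ k * exp (x\<^sup>2 / 2) * (deriv ^^ k) (\<lambda>t. exp (- t\<^sup>2 / 2)) x"

definition mhermite :: "nat ^ 'd \<Rightarrow> real ^ 'd \<Rightarrow> real" where
  "mhermite s x = (\<Prod>k\<in>UNIV. hermite (s $ k) (x $ k))"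

definition msize :: "nat ^ 'd \<Rightarrow> nat" where
  "msize s = (\<Sum>k\<in>UNIV. s $ k)"

definition partial :: "'d \<Rightarrow> (real ^ 'd \<Rightarrow> real) \<Rightarrow> real ^ 'd \<Rightarrow> real" where
  "partial k f x = deriv (\<lambda>t. f (x + t *\<^sub>R axis k 1)) 0"

definition mpartial ::
    "nat ^ 'd::{finite,linorder} \<Rightarrow> (real ^ 'd::{finite,linorder} \<Rightarrow> real) \<Rightarrow>
      real ^ 'd::{finite,linorder} \<Rightarrow> real" where
  "mpartial s f = foldr (\<lambda>k. partial k ^^ (s $ k)) (sorted_list_of_set UNIV) f"

definition laplacian :: "(real ^ 'd \<Rightarrow> real) \<Rightarrow> real ^ 'd \<Rightarrow> real" where
  "laplacian f x = (\<Sum>k\<in>UNIV. partial k (partial k f) x)"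

text \<open>
  Every iterated partial derivative, in any order of the coordinates, is (Frechet)
  differentiable, hence also continuous.
\<close>

definition smooth :: "(real ^ 'd \<Rightarrow> real) \<Rightarrow> bool" where
  "smooth f \<longleftrightarrow> (\<forall>ks. foldr partial ks f differentiable_on UNIV)"

text \<open>The multi-index series is an unordered sum, so convergence is absolute.\<close>

definition taylor_converges_everywhere :: "(real ^ 'd::{finite,linorder} \<Rightarrow> real) \<Rightarrow> bool" where
  "taylor_converges_everywhere f \<longleftrightarrow>
    (\<forall>c y. ((\<lambda>s. mpartial s f c / (\<Prod>k\<in>UNIV. fact (s $ k)) *
                (\<Prod>k\<in>UNIV. (y $ k - c $ k) ^ (s $ k))) has_sum f y) UNIV)"

definition real_vec :: "int ^ 'd \<Rightarrow> real ^ 'd" where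
  "real_vec i = (\<chi> k. real_of_int (i $ k))"

definition permute_coords :: "('d \<Rightarrow> 'd) \<Rightarrow> int ^ 'd \<Rightarrow> int ^ 'd" where
  "permute_coords \<pi> i = (\<chi> k. i $ \<pi> k)"

definition flip_coord :: "'d \<Rightarrow> int ^ 'd \<Rightarrow> int ^ 'd" where
  "flip_coord j i = (\<chi> k. if k = j then - (i $ k) else i $ k)"

definition invariant_weights :: "(int ^ 'd) set \<Rightarrow> (int ^ 'd \<Rightarrow> real) \<Rightarrow> bool" where
  "invariant_weights \<Omega> w \<longleftrightarrow>
    (\<forall>\<pi>. bij \<pi> \<longrightarrow> permute_coords \<pi> ` \<Omega> = \<Omega> \<and> (\<forall>i\<in>\<Omega>. w (permute_coords \<pi> i) = w i)) \<and>
    (\<forall>j. flip_coord j ` \<Omega> = \<Omega> \<and> (\<forall>i\<in>\<Omega>. w (flip_coord j i) = w i))"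

definition hermite_norm_preservation ::
    "nat \<Rightarrow> real \<Rightarrow> (int ^ 'd) set \<Rightarrow> (int ^ 'd \<Rightarrow> real) \<Rightarrow> bool" where
  "hermite_norm_preservation N a \<Omega> w \<longleftrightarrow>
    (\<forall>s. msize s \<le> N \<longrightarrow>
      (\<Sum>i\<in>\<Omega>. w i * (mhermite s (a *\<^sub>R real_vec i))\<^sup>2) =
      (\<integral>x. (\<Prod>k\<in>UNIV. (hermite (s $ k) (x $ k))\<^sup>2 * std_normal_density (x $ k)) \<partial>lborel))"

end

theory Submission imports Defs begin

text \<open>
  Invariance under sign changes and the norm preservation conditions force all moments of the scaled
  weights up to order \<open>2 N\<^sub>q + 1\<close> to be those of the standard Gaussian: odd moments vanish by symmetry,
  and the even ones are determined by the conditions.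
  Inserting the Taylor series of \<open>f\<close> truncated at order \<open>2 N\<^sub>q + 1 - n\<close>, each coefficient becomes the
  Gaussian expectation of \<open>H_s\<close> times a monomial of exponents \<open>r\<close>, which integration by parts evaluates;
  it is nonzero only for \<open>r = s + 2 t\<close>, and the multinomial expansion of \<open>\<Delta>^m\<close> collects these terms.
  Absolute convergence of the Taylor series at \<open>h = 1\<close> bounds the remainder.
\<close>

section \<open>Hermite polynomials and Gaussian moments\<close>

text \<open>Differentiating \<open>H_k(t) exp (-t^2/2)\<close> once gives, up to sign, this
  recursion. Working with formal polynomials makes degrees, coefficients and \<open>pderiv\<close>
  available.\<close>

primrec hermite_poly :: "nat \<Rightarrow> real poly" where
  "hermite_poly 0 = 1"
| "hermite_poly (Suc k) = pCons 0 (hermite_poly k) - pderiv (hermite_poly k)"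

lemma higher_deriv_gauss:
  "(deriv ^^ k) (\<lambda>t::real. exp (- t\<^sup>2 / 2)) =
    (\<lambda>t. (-1) ^ k * poly (hermite_poly k) t * exp (- t\<^sup>2 / 2))"
proof (induction k)
  case (Suc k)
  show ?case
  proof
    fix t :: real
    have "((\<lambda>t. (-1) ^ k * poly (hermite_poly k) t * exp (- t\<^sup>2 / 2)) has_real_derivative
        (-1) ^ Suc k * poly (hermite_poly (Suc k)) t * exp (- t\<^sup>2 / 2)) (at t)"
      by (auto intro!: derivative_eq_intros simp: algebra_simps)
    then show "(deriv ^^ Suc k) (\<lambda>t::real. exp (- t\<^sup>2 / 2)) t =
        (-1) ^ Suc k * poly (hermite_poly (Suc k)) t * exp (- t\<^sup>2 / 2)"
      by (simp only: funpow.simps o_apply Suc.IH DERIV_imp_deriv)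
  qed
qed simp

lemma hermite_eq_poly: "hermite k x = poly (hermite_poly k) x"
proof -
  have "hermite k x = ((-1) ^ k * (-1) ^ k) * (exp (x\<^sup>2 / 2) * exp (- x\<^sup>2 / 2)) * poly (hermite_poly k) x"
    by (simp only: hermite_def higher_deriv_gauss mult_ac)
  also have "exp (x\<^sup>2 / 2) * exp (- x\<^sup>2 / 2) = 1"
    by (simp flip: exp_add)
  finally show ?thesis
    by (simp flip: power_mult_distrib)
qed

lemma degree_hermite_poly_le: "degree (hermite_poly k) \<le> k"
proof (induction k)
  case (Suc k)
  then have "degree (pCons 0 (hermite_poly k)) \<le> Suc k" "degree (pderiv (hermite_poly k)) \<le> Suc k"
    by (auto simp: degree_pderiv)
  then show ?case
    by (auto intro: degree_diff_le)
qed simp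

text \<open>Monicity is what later allows each norm condition to be solved for a single
  moment.\<close>

lemma coeff_hermite_poly_self [simp]: "coeff (hermite_poly k) k = 1"
proof (induction k)
  case (Suc k)
  have "coeff (hermite_poly k) (Suc (Suc k)) = 0"
    using degree_hermite_poly_le[of k] by (intro coeff_eq_0) auto
  with Suc show ?case
    by (simp add: coeff_pderiv)
qed simp

lemma degree_hermite_poly [simp]: "degree (hermite_poly k) = k"
  by (intro antisym degree_hermite_poly_le le_degree) simp

section \<open>Gaussian expectation as a linear functional on polynomials\<close>

definition gauss_expect :: "real poly \<Rightarrow> real" where
  "gauss_expect p = (\<integral>x. poly p x * std_normal_density x \<partial>lborel)"

lemma integrable_poly_gauss: "integrable lborel (\<lambda>x. poly p x * std_normal_density x)"
proof -
  have "integrable lborel (\<lambda>x. \<Sum>i\<le>degree p. coeff p i * (std_normal_density x * x ^ i))"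
    by (intro Bochner_Integration.integrable_sum integrable_mult_right integrable_std_normal_moment)
  then show ?thesis
    by (simp add: poly_altdef sum_distrib_left mult_ac)
qed

lemma gauss_expect_add: "gauss_expect (p + q) = gauss_expect p + gauss_expect q"
  by (simp add: gauss_expect_def distrib_right integrable_poly_gauss)

lemma gauss_expect_diff: "gauss_expect (p - q) = gauss_expect p - gauss_expect q"
  by (simp add: gauss_expect_def left_diff_distrib integrable_poly_gauss)

lemma gauss_expect_smult: "gauss_expect (smult c p) = c * gauss_expect p"
  by (simp add: gauss_expect_def mult.assoc)

lemma gauss_expect_0 [simp]: "gauss_expect 0 = 0"
  by (simp add: gauss_expect_def)

lemma gauss_expect_sum: "gauss_expect (\<Sum>i\<in>A. p i) = (\<Sum>i\<in>A. gauss_expect (p i))"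
  by (induction A rule: infinite_finite_induct) (simp_all add: gauss_expect_add)

definition gauss_moment :: "nat \<Rightarrow> real" where
  "gauss_moment n = gauss_expect (monom 1 n)"

lemma gauss_moment_even: "gauss_moment (2 * k) = fact (2 * k) / (2 ^ k * fact k)"
  using integral_std_normal_moment_even[of k]
  by (simp add: gauss_moment_def gauss_expect_def poly_monom mult.commute)

lemma gauss_moment_odd: "odd n \<Longrightarrow> gauss_moment n = 0"
  using integral_std_normal_moment_odd
  by (elim oddE) (simp add: gauss_moment_def gauss_expect_def poly_monom mult.commute)

lemma gauss_expect_monom: "gauss_expect (monom c n) = c * gauss_moment n"
  using gauss_expect_smult[of c "monom 1 n"] by (simp add: gauss_moment_def smult_monom)

text \<open>This has the shape of \<open>poly_altdef\<close> with moments in place of powers, so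
  \<open>prod_poly_expand\<close> applies to both.\<close>

lemma gauss_expect_altdef: "gauss_expect p = (\<Sum>i\<le>degree p. coeff p i * gauss_moment i)"
  by (subst poly_as_sum_of_monoms[symmetric]) (simp only: gauss_expect_sum gauss_expect_monom)

lemma gauss_moment_Suc: "gauss_moment (Suc n) = of_nat n * gauss_moment (n - 1)"
proof (cases "even n")
  case True
  then show ?thesis
    \<comment> \<open>For \<open>n = 0\<close> the truncated \<open>n - 1\<close> is
      \<open>0\<close>, but the factor \<open>of_nat n\<close> vanishes; for even
      \<open>n > 0\<close> both moments are odd.\<close>
    by (cases n) (auto simp: gauss_moment_odd)
next
  case False
  then obtain k where n: "n = 2 * k + 1"
    by (elim oddE)
  have "gauss_moment (2 * Suc k) = of_nat (2 * k + 1) * gauss_moment (2 * k)"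
    unfolding gauss_moment_even by (simp add: divide_simps)
  then show ?thesis
    by (simp add: n)
qed

text \<open>Stein's identity, i.e. integration by parts against the Gaussian density.\<close>

lemma gauss_expect_pCons_0: "gauss_expect (pCons 0 p) = gauss_expect (pderiv p)"
proof -
  \<comment> \<open>On monomials the identity is the moment recursion
    \<open>gauss_moment_Suc\<close>; linearity gives the rest.\<close>
  have monom: "gauss_expect (pCons 0 (monom c n)) = gauss_expect (pderiv (monom c n))" for c n
    by (simp add: pderiv_monom gauss_expect_monom gauss_moment_Suc flip: monom_Suc)
  have pCons_sum: "pCons 0 (\<Sum>i\<in>A. q i) = (\<Sum>i\<in>A. pCons 0 (q i))"
    for A :: "nat set" and q :: "nat \<Rightarrow> real poly"
    by (rule poly_eqI) (simp add: coeff_pCons coeff_sum split: nat.split)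
  note pderiv_sum = higher_pderiv_sum[of "Suc 0", simplified]
  have "gauss_expect (pCons 0 (\<Sum>i\<le>degree p. monom (coeff p i) i)) =
      gauss_expect (pderiv (\<Sum>i\<le>degree p. monom (coeff p i) i))"
    by (simp only: pCons_sum pderiv_sum gauss_expect_sum monom)
  then show ?thesis
    by (simp only: poly_as_sum_of_monoms)
qed

text \<open>In \<open>H_(k+1) p = x H_k p - H_k' p\<close>, Stein's identity replaces the first term
  by \<open>(H_k p)'\<close>. The terms \<open>H_k' p\<close> cancel, and one derivative has moved
  onto \<open>p\<close>.\<close>

lemma gauss_expect_hermite_mult:
  "gauss_expect (hermite_poly k * p) = gauss_expect ((pderiv ^^ k) p)"
proof (induction k arbitrary: p)
  case (Suc k)
  have "gauss_expect (hermite_poly (Suc k) * p) = gauss_expect (pCons 0 (hermite_poly k * p))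
      - gauss_expect (pderiv (hermite_poly k) * p)"
    by (simp add: left_diff_distrib gauss_expect_diff)
  also have "\<dots> = gauss_expect (hermite_poly k * pderiv p)"
    by (simp add: gauss_expect_pCons_0 pderiv_mult gauss_expect_add mult.commute)
  finally show ?case
    by (simp add: Suc.IH funpow_swap1)
qed simp

lemma higher_pderiv_monom_1:
  "(pderiv ^^ k) (monom (1::real) r) = (if k \<le> r then monom (fact r / fact (r - k)) (r - k) else 0)"
proof (induction k)
  case (Suc k)
  show ?case
  proof (cases "Suc k \<le> r")
    case True
    then have "fact (r - k) = of_nat (r - k) * (fact (r - Suc k) :: real)"
      by (metis Suc_diff_Suc Suc_le_eq fact_Suc of_nat_fact of_nat_mult)
    with True Suc show ?thesis
      by (simp add: pderiv_monom)
  next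
    case False
    with Suc show ?thesis
      by (auto simp: pderiv_monom)
  qed
qed simp

lemma gauss_expect_hermite_monom:
  "gauss_expect (hermite_poly k * monom 1 r) =
    (if k \<le> r then fact r / fact (r - k) * gauss_moment (r - k) else 0)"
  by (simp add: gauss_expect_hermite_mult higher_pderiv_monom_1 gauss_expect_monom)

section \<open>Moments of invariant weights\<close>

text \<open>Fubini over the coordinates, needed to factor the integrals in the norm
  conditions.\<close>

lemma integral_lborel_prod_vec:
  fixes g :: "'d::finite \<Rightarrow> real \<Rightarrow> real"
  assumes "\<And>k. integrable lborel (g k)"
  shows "(\<integral>x. (\<Prod>k\<in>UNIV. g k (x $ k)) \<partial>(lborel :: (real ^ 'd) measure)) =
    (\<Prod>k\<in>UNIV. \<integral>x. g k x \<partial>lborel)"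
proof -
  interpret product_sigma_finite "\<lambda>_::real ^ 'd. lborel :: real measure" ..
  define e :: "'d \<Rightarrow> real ^ 'd" where "e = (\<lambda>k. axis k 1)"
  have bij: "bij_betw e UNIV Basis"
    by (auto simp: e_def bij_betw_def inj_on_def axis_eq_axis Basis_vec_def)
  \<comment> \<open>\<open>lborel_eq\<close> presents Lebesgue measure as the image of a product
    indexed by \<open>Basis\<close>, so the factors are reindexed from coordinates to unit
    vectors.\<close>
  define g' where "g' = (\<lambda>b. g (inv_into UNIV e b))"
  have e_inner: "x \<bullet> e k = x $ k" for x k
    by (simp add: e_def inner_axis)
  have [simp]: "inv_into UNIV e (e k) = k" for k
    using bij by (simp add: bij_betw_def inv_f_f)
  have meas: "g' b \<in> borel_measurable borel" for b
    using borel_measurable_integrable[OF assms] by (simp add: g'_def)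
  have eq: "(\<Prod>k\<in>UNIV. g k (x $ k)) = (\<Prod>b\<in>Basis. g' b (x \<bullet> b))" for x
    by (subst prod.reindex_bij_betw[OF bij, symmetric]) (simp add: g'_def e_inner)
  have [simp]: "(\<Sum>b\<in>Basis. y b *\<^sub>R b) \<bullet> c = y c" if "c \<in> Basis" for y and c :: "real ^ 'd"
    using that by (rule inner_sum_left_Basis)
  have "(\<integral>x. (\<Prod>k\<in>UNIV. g k (x $ k)) \<partial>(lborel :: (real ^ 'd) measure)) =
      (\<integral>y. (\<Prod>b\<in>Basis. g' b (y b)) \<partial>(\<Pi>\<^sub>M b\<in>(Basis :: (real ^ 'd) set). lborel))"
    unfolding eq using meas by (subst lborel_eq, subst integral_distr) auto
  also have "\<dots> = (\<Prod>b\<in>(Basis :: (real ^ 'd) set). \<integral>x. g' b x \<partial>lborel)"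
    by (rule product_integral_prod) (use assms in \<open>auto simp: g'_def\<close>)
  also have "\<dots> = (\<Prod>k\<in>UNIV. \<integral>x. g k x \<partial>lborel)"
    by (subst prod.reindex_bij_betw[OF bij, symmetric]) (simp add: g'_def)
  finally show ?thesis .
qed

text \<open>The family \<open>m\<close> is left free: powers of coordinates give the weighted side,
  \<open>gauss_moment\<close> the Gaussian side, with identical coefficients.\<close>

lemma prod_poly_expand:
  fixes p :: "'d::finite \<Rightarrow> 'a::comm_ring_1 poly" and m :: "'d \<Rightarrow> nat \<Rightarrow> 'a"
  shows "(\<Prod>k\<in>UNIV. \<Sum>i\<le>degree (p k). coeff (p k) i * m k i) =
    (\<Sum>e\<in>Pi\<^sub>E UNIV (\<lambda>k. {..degree (p k)}).
      (\<Prod>k\<in>UNIV. coeff (p k) (e k)) * (\<Prod>k\<in>UNIV. m k (e k)))"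
  by (subst prod_sum_PiE) (simp_all add: prod.distrib)

text \<open>Both sides are the same linear combination of moments whose exponents are bounded by the
  degrees, so it suffices to compare these.\<close>

lemma weighted_prod_poly_eq_gauss:
  fixes p :: "'d::finite \<Rightarrow> real poly" and y :: "'i \<Rightarrow> 'd \<Rightarrow> real"
  assumes "\<And>e. (\<And>k. e k \<le> degree (p k)) \<Longrightarrow>
    (\<Sum>i\<in>\<Omega>. w i * (\<Prod>k\<in>UNIV. y i k ^ e k)) = (\<Prod>k\<in>UNIV. gauss_moment (e k))"
  shows "(\<Sum>i\<in>\<Omega>. w i * (\<Prod>k\<in>UNIV. poly (p k) (y i k))) = (\<Prod>k\<in>UNIV. gauss_expect (p k))"
proof -
  have "(\<Sum>i\<in>\<Omega>. w i * (\<Prod>k\<in>UNIV. poly (p k) (y i k))) =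
      (\<Sum>e\<in>Pi\<^sub>E UNIV (\<lambda>k. {..degree (p k)}).
        (\<Prod>k\<in>UNIV. coeff (p k) (e k)) * (\<Sum>i\<in>\<Omega>. w i * (\<Prod>k\<in>UNIV. y i k ^ e k)))"
    unfolding poly_altdef prod_poly_expand sum_distrib_left
    by (subst sum.swap) (simp add: mult_ac)
  also have "\<dots> = (\<Sum>e\<in>Pi\<^sub>E UNIV (\<lambda>k. {..degree (p k)}).
        (\<Prod>k\<in>UNIV. coeff (p k) (e k)) * (\<Prod>k\<in>UNIV. gauss_moment (e k)))"
    by (intro sum.cong refl) (subst assms, auto simp: PiE_iff)
  also have "\<dots> = (\<Prod>k\<in>UNIV. gauss_expect (p k))"
    by (simp add: gauss_expect_altdef prod_poly_expand)
  finally show ?thesis .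
qed

text \<open>Reflecting coordinate \<open>j\<close> permutes the nodes, keeps the weights and negates
  the monomial, so the sum equals its own negative.\<close>

lemma weighted_moment_odd:
  fixes e :: "'d::finite \<Rightarrow> nat"
  assumes "invariant_weights \<Omega> w" and "odd (e j)"
  shows "(\<Sum>i\<in>\<Omega>. w i * (\<Prod>k\<in>UNIV. (a * real_of_int (i $ k)) ^ e k)) = 0"
proof -
  let ?F = "\<lambda>i. \<Prod>k\<in>UNIV. (a * real_of_int (i $ k)) ^ e k"
  have flip: "flip_coord j ` \<Omega> = \<Omega>" "\<And>i. i \<in> \<Omega> \<Longrightarrow> w (flip_coord j i) = w i"
    using assms(1) by (auto simp: invariant_weights_def)
  have inj: "inj_on (flip_coord j) \<Omega>"
    by (rule inj_on_inverseI[of _ "flip_coord j"]) (auto simp: flip_coord_def vec_eq_iff)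
  have F: "?F (flip_coord j i) = - ?F i" for i
  proof -
    have "(\<Prod>k\<in>UNIV - {j}. (a * real_of_int (flip_coord j i $ k)) ^ e k) =
        (\<Prod>k\<in>UNIV - {j}. (a * real_of_int (i $ k)) ^ e k)"
      by (intro prod.cong) (auto simp: flip_coord_def)
    moreover have "(a * real_of_int (flip_coord j i $ j)) ^ e j = - ((a * real_of_int (i $ j)) ^ e j)"
      using assms(2) by (simp add: flip_coord_def power_minus_odd)
    ultimately show ?thesis
      by (simp add: prod.remove[of UNIV j])
  qed
  have "(\<Sum>i\<in>\<Omega>. w i * ?F i) = (\<Sum>i\<in>flip_coord j ` \<Omega>. w i * ?F i)"
    by (simp add: flip)
  also have "\<dots> = (\<Sum>i\<in>\<Omega>. w (flip_coord j i) * ?F (flip_coord j i))"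
    by (simp add: sum.reindex[OF inj])
  also have "\<dots> = - (\<Sum>i\<in>\<Omega>. w i * ?F i)"
    by (simp add: F flip sum_negf)
  finally show ?thesis
    by simp
qed

text \<open>
  Modulo monomials of smaller order, which are covered by induction, the square of \<open>H_t\<close> is the
  monomial with exponents \<open>2 t\<close>; the norm preservation condition for \<open>t\<close> therefore fixes the
  moment with exponents \<open>2 t\<close>.
\<close>

lemma weighted_moment_eq_gauss:
  fixes e :: "'d::finite \<Rightarrow> nat" and w :: "int ^ 'd \<Rightarrow> real"
  assumes inv: "invariant_weights \<Omega> w" and pres: "hermite_norm_preservation N a \<Omega> w"
    and "(\<Sum>k\<in>UNIV. e k) \<le> 2 * N + 1"
  shows "(\<Sum>i\<in>\<Omega>. w i * (\<Prod>k\<in>UNIV. (a * real_of_int (i $ k)) ^ e k)) =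
    (\<Prod>k\<in>UNIV. gauss_moment (e k))"
  using assms(3)
proof (induction "\<Sum>k\<in>UNIV. e k" arbitrary: e rule: less_induct)
  case (less e)
  let ?L = "\<lambda>e. \<Sum>i\<in>\<Omega>. w i * (\<Prod>k\<in>UNIV. (a * real_of_int (i $ k)) ^ e k)"
  show ?case
  proof (cases "\<exists>j. odd (e j)")
    case True
    then obtain j where j: "odd (e j)" ..
    have "(\<Prod>k\<in>UNIV. gauss_moment (e k)) = 0"
      using gauss_moment_odd[OF j] by (auto simp: prod_zero_iff)
    with weighted_moment_odd[of \<Omega> w e j a, OF inv j] show ?thesis
      by simp
  next
    case False
    define t :: "nat ^ 'd" where "t = (\<chi> k. e k div 2)"
    have e: "e k = t $ k + t $ k" for k
      using False by (metis even_two_times_div_two mult_2 t_def vec_lambda_beta)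
    define p where "p = (\<lambda>k. hermite_poly (t $ k) * hermite_poly (t $ k))"
    have ne: "hermite_poly k \<noteq> 0" for k
      using coeff_hermite_poly_self[of k] by (metis coeff_0 zero_neq_one)
    have deg: "degree (p k) = e k" for k
      by (simp add: p_def degree_mult_eq e ne)
    have lead: "coeff (p k) (e k) = 1" for k
      using coeff_mult_degree_sum[of "hermite_poly (t $ k)" "hermite_poly (t $ k)"] by (simp add: p_def e)
    let ?E = "Pi\<^sub>E UNIV (\<lambda>k. {..e k})"
    \<comment> \<open>The total order is even, so the bound \<open>2 * N + 1\<close> really gives
      \<open>2 * N\<close>, and the norm condition for \<open>t\<close> applies.\<close>
    have "(\<Sum>k\<in>UNIV. e k) = 2 * msize t"
      by (simp add: msize_def e sum.distrib)
    then have "msize t \<le> N"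
      using less.prems by simp
    then have "(\<Sum>i\<in>\<Omega>. w i * (mhermite t (a *\<^sub>R real_vec i))\<^sup>2) =
        (\<integral>x. (\<Prod>k\<in>UNIV. (hermite (t $ k) (x $ k))\<^sup>2 * std_normal_density (x $ k)) \<partial>lborel)"
      using pres by (simp add: hermite_norm_preservation_def)
    also have "\<dots> = (\<Prod>k\<in>UNIV. gauss_expect (p k))"
      using integrable_poly_gauss[of "p _"]
      by (subst integral_lborel_prod_vec) (auto simp: gauss_expect_def p_def hermite_eq_poly power2_eq_square)
    \<comment> \<open>From here the two sides of the norm condition are expanded in turn over the
      same exponents, with the leading one, \<open>e\<close>, split off.\<close>
    also have "(\<Sum>i\<in>\<Omega>. w i * (mhermite t (a *\<^sub>R real_vec i))\<^sup>2) =
        (\<Sum>i\<in>\<Omega>. w i * (\<Prod>k\<in>UNIV. poly (p k) (a * real_of_int (i $ k))))"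
      by (simp add: mhermite_def hermite_eq_poly p_def real_vec_def power2_eq_square prod.distrib)
    also have "\<dots> = (\<Sum>c\<in>?E. (\<Prod>k\<in>UNIV. coeff (p k) (c k)) * ?L c)"
      unfolding poly_altdef prod_poly_expand unfolding deg sum_distrib_left
      by (subst sum.swap) (simp add: mult_ac)
    also have "\<dots> = ?L e + (\<Sum>c\<in>?E - {e}. (\<Prod>k\<in>UNIV. coeff (p k) (c k)) * ?L c)"
      by (subst sum.remove[of _ e]) (auto simp: lead intro!: finite_PiE)
    also have "(\<Prod>k\<in>UNIV. gauss_expect (p k)) =
        (\<Sum>c\<in>?E. (\<Prod>k\<in>UNIV. coeff (p k) (c k)) * (\<Prod>k\<in>UNIV. gauss_moment (c k)))"
      unfolding gauss_expect_altdef prod_poly_expand unfolding deg ..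
    also have "\<dots> = (\<Prod>k\<in>UNIV. gauss_moment (e k)) +
        (\<Sum>c\<in>?E - {e}. (\<Prod>k\<in>UNIV. coeff (p k) (c k)) * (\<Prod>k\<in>UNIV. gauss_moment (c k)))"
      by (subst sum.remove[of _ e]) (auto simp: lead intro!: finite_PiE)
    \<comment> \<open>The remaining exponents lie below \<open>e\<close> everywhere and strictly
      somewhere. By the induction hypothesis the two remainders agree and cancel.\<close>
    also have "(\<Sum>c\<in>?E - {e}. (\<Prod>k\<in>UNIV. coeff (p k) (c k)) * (\<Prod>k\<in>UNIV. gauss_moment (c k))) =
        (\<Sum>c\<in>?E - {e}. (\<Prod>k\<in>UNIV. coeff (p k) (c k)) * ?L c)"
    proof (intro sum.cong refl)
      fix c assume c: "c \<in> ?E - {e}"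
      then have le: "c k \<le> e k" for k
        by auto
      from c obtain j where "c j \<noteq> e j"
        by auto
      with le[of j] have "c j < e j"
        by simp
      then have "(\<Sum>k\<in>UNIV. c k) < (\<Sum>k\<in>UNIV. e k)"
        by (intro sum_strict_mono_ex1) (auto simp: le)
      with less show "(\<Prod>k\<in>UNIV. coeff (p k) (c k)) * (\<Prod>k\<in>UNIV. gauss_moment (c k)) =
          (\<Prod>k\<in>UNIV. coeff (p k) (c k)) * ?L c"
        by simp
    qed
    finally show ?thesis
      by simp
  qed
qed

text \<open>In coordinate \<open>k\<close> the polynomial has degree at most
  \<open>s $ k + r $ k\<close>, so every monomial occurring has total order at most
  \<open>2 * N + 1\<close>.\<close>

lemma weighted_hermite_moment:
  fixes s r :: "nat ^ 'd::finite" and w :: "int ^ 'd \<Rightarrow> real"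
  assumes "invariant_weights \<Omega> w" and "hermite_norm_preservation N a \<Omega> w"
    and "msize s + msize r \<le> 2 * N + 1"
  shows "(\<Sum>i\<in>\<Omega>. w i * mhermite s (a *\<^sub>R real_vec i) * (\<Prod>k\<in>UNIV. (a * real_of_int (i $ k)) ^ (r $ k))) =
    (\<Prod>k\<in>UNIV. gauss_expect (hermite_poly (s $ k) * monom 1 (r $ k)))"
proof -
  have "(\<Sum>k\<in>UNIV. e k) \<le> 2 * N + 1"
    if "\<And>k. e k \<le> degree (hermite_poly (s $ k) * monom 1 (r $ k))" for e
  proof -
    have "e k \<le> s $ k + r $ k" for k
      using that[of k] degree_mult_le[of "hermite_poly (s $ k)" "monom 1 (r $ k)"] by (simp add: degree_monom_eq)
    then have "(\<Sum>k\<in>UNIV. e k) \<le> (\<Sum>k\<in>UNIV. s $ k + r $ k)"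
      by (intro sum_mono)
    with assms(3) show ?thesis
      by (simp add: msize_def sum.distrib)
  qed
  from weighted_prod_poly_eq_gauss[where p = "\<lambda>k. hermite_poly (s $ k) * monom 1 (r $ k)",
      OF weighted_moment_eq_gauss[OF assms(1,2) this]]
  show ?thesis
    by (simp add: mhermite_def hermite_eq_poly real_vec_def poly_monom prod.distrib mult.assoc)
qed

section \<open>Iterated partial derivatives\<close>

lemma foldr_partial_append: "foldr partial (ks @ ls) f = foldr partial ks (foldr partial ls f)"
  by simp

lemma smooth_foldr_partial: "smooth f \<Longrightarrow> smooth (foldr partial ks f)"
  unfolding smooth_def foldr_partial_append[symmetric] by blast

lemma smooth_partial: "smooth f \<Longrightarrow> smooth (partial k f)"
  using smooth_foldr_partial[of f "[k]"] by simp

lemma smooth_imp_differentiable: "smooth f \<Longrightarrow> f differentiable (at x)"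
  by (auto simp: smooth_def differentiable_on_def dest: spec[of _ "[]"])

text \<open>\<open>partial\<close> is a derivative at parameter \<open>0\<close>; the mean value
  theorem below needs it along a whole coordinate line.\<close>

lemma has_real_derivative_partial:
  fixes f :: "real ^ 'd \<Rightarrow> real"
  assumes "f differentiable (at (x + t *\<^sub>R axis k 1))"
  shows "((\<lambda>t. f (x + t *\<^sub>R axis k 1)) has_real_derivative partial k f (x + t *\<^sub>R axis k 1)) (at t)"
proof -
  let ?y = "x + t *\<^sub>R axis k 1 :: real ^ 'd"
  obtain D where D: "(f has_derivative D) (at ?y)"
    using assms by (auto simp: differentiable_def)
  \<comment> \<open>Kept general in \<open>x\<close> and \<open>t\<close>: at \<open>?y\<close> with
    parameter \<open>0\<close> it identifies \<open>partial k f ?y\<close>, at the original point it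
    yields the claim.\<close>
  have line: "((\<lambda>t. f (x + t *\<^sub>R axis k 1)) has_real_derivative D (axis k 1)) (at t)"
    if "(f has_derivative D) (at (x + t *\<^sub>R axis k 1))" for x :: "real ^ 'd" and t
  proof -
    have "((\<lambda>t. x + t *\<^sub>R axis k 1) has_derivative (\<lambda>u. u *\<^sub>R axis k 1)) (at t)"
      by (auto intro!: derivative_eq_intros)
    from has_derivative_compose[OF this that]
    have "((\<lambda>t. f (x + t *\<^sub>R axis k 1)) has_derivative (\<lambda>u. D (u *\<^sub>R axis k 1))) (at t)" .
    moreover have "D (u *\<^sub>R axis k 1) = D (axis k 1) * u" for u
      using linear_scale[OF has_derivative_linear[OF that]] by (simp add: mult.commute)
    ultimately show ?thesis
      by (simp add: has_field_derivative_def)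
  qed
  have "((\<lambda>u. f (?y + u *\<^sub>R axis k 1)) has_real_derivative D (axis k 1)) (at 0)"
    using D by (intro line) simp
  then have "partial k f ?y = D (axis k 1)"
    unfolding partial_def by (rule DERIV_imp_deriv)
  with line[OF D] show ?thesis
    by simp
qed

lemma partial_sum_scaled:
  assumes "\<And>i. i \<in> A \<Longrightarrow> g i differentiable (at x)"
  shows "partial k (\<lambda>y. \<Sum>i\<in>A. c i * g i y) x = (\<Sum>i\<in>A. c i * partial k (g i) x)"
proof -
  have "((\<lambda>t. \<Sum>i\<in>A. c i * g i (x + t *\<^sub>R axis k 1)) has_real_derivative
      (\<Sum>i\<in>A. c i * partial k (g i) x)) (at 0)"
  proof (intro DERIV_sum DERIV_cmult)
    fix i assume "i \<in> A"
    with assms show "((\<lambda>t. g i (x + t *\<^sub>R axis k 1)) has_real_derivative partial k (g i) x) (at 0)"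
      using has_real_derivative_partial[of "g i" x 0 k] by simp
  qed
  then show ?thesis
    unfolding partial_def[of k "\<lambda>y. \<Sum>i\<in>A. c i * g i y"] by (rule DERIV_imp_deriv)
qed

section \<open>Symmetry of mixed partial derivatives\<close>

lemma mixed_difference_eq_partial:
  fixes f :: "real ^ 'd \<Rightarrow> real"
  assumes "smooth f" and "t > 0"
  shows "\<exists>p. dist p x \<le> 2 * t \<and>
    f (x + t *\<^sub>R axis j 1 + t *\<^sub>R axis k 1) - f (x + t *\<^sub>R axis j 1) - f (x + t *\<^sub>R axis k 1) + f x =
      t\<^sup>2 * partial k (partial j f) p"
proof -
  define ej ek :: "real ^ 'd" where "ej = axis j 1" and "ek = axis k 1"
  note D = has_real_derivative_partial[OF smooth_imp_differentiable]
  \<comment> \<open>The mean value theorem is used twice: along \<open>ej\<close> for the increment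
    of \<open>f\<close> across \<open>t *\<^sub>R ek\<close>, then along \<open>ek\<close> for
    \<open>partial j f\<close>.\<close>
  have D1: "((\<lambda>u. f ((x + t *\<^sub>R ek) + u *\<^sub>R ej) - f (x + u *\<^sub>R ej)) has_real_derivative
      partial j f ((x + t *\<^sub>R ek) + u *\<^sub>R ej) - partial j f (x + u *\<^sub>R ej)) (at u)" for u
    unfolding ej_def by (intro DERIV_diff D[OF assms(1)])
  obtain \<xi> where \<xi>: "0 < \<xi>" "\<xi> < t"
    "(f ((x + t *\<^sub>R ek) + t *\<^sub>R ej) - f (x + t *\<^sub>R ej)) - (f ((x + t *\<^sub>R ek) + 0 *\<^sub>R ej) - f (x + 0 *\<^sub>R ej)) =
      (t - 0) * (partial j f ((x + t *\<^sub>R ek) + \<xi> *\<^sub>R ej) - partial j f (x + \<xi> *\<^sub>R ej))"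
    using MVT2[OF assms(2) D1] by blast
  have D2: "((\<lambda>u. partial j f ((x + \<xi> *\<^sub>R ej) + u *\<^sub>R ek)) has_real_derivative
      partial k (partial j f) ((x + \<xi> *\<^sub>R ej) + u *\<^sub>R ek)) (at u)" for u
    unfolding ek_def by (rule D[OF smooth_partial[OF assms(1)]])
  obtain \<eta> where \<eta>: "0 < \<eta>" "\<eta> < t"
    "partial j f ((x + \<xi> *\<^sub>R ej) + t *\<^sub>R ek) - partial j f ((x + \<xi> *\<^sub>R ej) + 0 *\<^sub>R ek) =
      (t - 0) * partial k (partial j f) ((x + \<xi> *\<^sub>R ej) + \<eta> *\<^sub>R ek)"
    using MVT2[OF assms(2) D2] by blast
  have "dist (x + \<xi> *\<^sub>R ej + \<eta> *\<^sub>R ek) x \<le> norm (\<xi> *\<^sub>R ej) + norm (\<eta> *\<^sub>R ek)"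
    using norm_triangle_ineq by (simp add: dist_norm add.assoc del: norm_scaleR)
  also have "\<dots> \<le> 2 * t"
    using \<xi> \<eta> by (simp add: ej_def ek_def)
  finally have "dist (x + \<xi> *\<^sub>R ej + \<eta> *\<^sub>R ek) x \<le> 2 * t" .
  moreover have "f (x + t *\<^sub>R ej + t *\<^sub>R ek) - f (x + t *\<^sub>R ej) - f (x + t *\<^sub>R ek) + f x =
      t\<^sup>2 * partial k (partial j f) (x + \<xi> *\<^sub>R ej + \<eta> *\<^sub>R ek)"
  proof -
    have swap: "x + t *\<^sub>R ek + u *\<^sub>R ej = x + u *\<^sub>R ej + t *\<^sub>R ek" for u
      by (simp add: add_ac)
    show ?thesis
      using \<xi>(3) \<eta>(3) by (simp add: swap power2_eq_square)
  qed
  ultimately show ?thesis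
    unfolding ej_def ek_def by blast
qed

text \<open>The second difference quotient is symmetric in \<open>j\<close> and \<open>k\<close>. By
  continuity its limit is either mixed partial, so these coincide.\<close>

lemma partial_commute:
  fixes f :: "real ^ 'd \<Rightarrow> real"
  assumes "smooth f"
  shows "partial j (partial k f) = partial k (partial j f)"
proof
  fix x :: "real ^ 'd"
  define Q where "Q = (\<lambda>j k t. (f (x + t *\<^sub>R axis j 1 + t *\<^sub>R axis k 1) - f (x + t *\<^sub>R axis j 1)
    - f (x + t *\<^sub>R axis k 1) + f x) / t\<^sup>2)"
  have lim: "(Q j k \<longlongrightarrow> partial k (partial j f) x) (at_right 0)" for j k
  proof -
    \<comment> \<open>The condition \<open>t > 0\<close> sits inside the existential so that choice
      gives a total function of \<open>t\<close>.\<close>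
    have "\<forall>t. \<exists>p. t > 0 \<longrightarrow> dist p x \<le> 2 * t \<and> Q j k t = partial k (partial j f) p"
    proof (intro allI)
      fix t
      show "\<exists>p. t > 0 \<longrightarrow> dist p x \<le> 2 * t \<and> Q j k t = partial k (partial j f) p"
      proof (cases "t > 0")
        case True
        from mixed_difference_eq_partial[OF assms True, of x j k]
        obtain p where "dist p x \<le> 2 * t"
          "f (x + t *\<^sub>R axis j 1 + t *\<^sub>R axis k 1) - f (x + t *\<^sub>R axis j 1) - f (x + t *\<^sub>R axis k 1) + f x =
            t\<^sup>2 * partial k (partial j f) p" by (elim exE conjE)
        with True have "dist p x \<le> 2 * t \<and> Q j k t = partial k (partial j f) p"
          by (simp add: Q_def)
        then show ?thesis by (intro exI impI)
      qed simp
    qed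
    then obtain p where p: "\<forall>t. t > 0 \<longrightarrow> dist (p t) x \<le> 2 * t \<and> Q j k t = partial k (partial j f) (p t)"
      by (elim choice[THEN exE])
    have "((\<lambda>t. dist (p t) x) \<longlongrightarrow> 0) (at_right 0)"
    proof (rule tendsto_sandwich[of "\<lambda>_. 0" _ _ "\<lambda>t. 2 * t"])
      show "\<forall>\<^sub>F t in at_right 0. dist (p t) x \<le> 2 * t"
        using eventually_at_right_less[of 0] by eventually_elim (simp add: p)
    qed (auto intro!: tendsto_eq_intros)
    then have "(p \<longlongrightarrow> x) (at_right 0)"
      by (rule tendsto_dist_iff[THEN iffD2])
    moreover have "isCont (partial k (partial j f)) x"
      using assms by (simp add: differentiable_imp_continuous_within smooth_imp_differentiable smooth_partial)
    ultimately have "((\<lambda>t. partial k (partial j f) (p t)) \<longlongrightarrow> partial k (partial j f) x) (at_right 0)"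
      by (rule isCont_tendsto_compose[rotated])
    moreover have "\<forall>\<^sub>F t in at_right 0. partial k (partial j f) (p t) = Q j k t"
      using eventually_at_right_less[of 0] by eventually_elim (simp add: p)
    ultimately show ?thesis
      by (rule Lim_transform_eventually)
  qed
  have "Q k j = Q j k"
  proof
    fix t
    have "x + t *\<^sub>R axis k 1 + t *\<^sub>R axis j 1 = x + t *\<^sub>R axis j 1 + t *\<^sub>R axis k 1"
      by (simp add: add_ac)
    then show "Q k j t = Q j k t"
      unfolding Q_def by (simp only:) simp
  qed
  with lim[of k j] have "(Q j k \<longlongrightarrow> partial j (partial k f) x) (at_right 0)"
    by simp
  from tendsto_unique[OF trivial_limit_at_right_real this lim]
  show "partial j (partial k f) x = partial k (partial j f) x" .
qed

lemma foldr_partial_move: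
  assumes "smooth f"
  shows "foldr partial (ks @ k # ls) f = partial k (foldr partial (ks @ ls) f)"
proof (induction ks)
  case (Cons j ks)
  have "foldr partial ((j # ks) @ k # ls) f = partial j (partial k (foldr partial (ks @ ls) f))"
    using Cons by simp
  also have "\<dots> = partial k (partial j (foldr partial (ks @ ls) f))"
    by (intro partial_commute smooth_foldr_partial assms)
  finally show ?case
    by simp
qed simp

text \<open>An occurrence in \<open>ls\<close> of the head of \<open>ks\<close> is moved to the
  front; the induction hypothesis compares what is left.\<close>

lemma foldr_partial_cong_mset:
  assumes "smooth f" and "mset ks = mset ls"
  shows "foldr partial ks f = foldr partial ls f"
  using assms(2)
proof (induction ks arbitrary: ls)
  case (Cons k ks)
  then have "k \<in> set ls"
    by (metis list.set_intros(1) set_mset_mset)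
  then obtain as bs where ls: "ls = as @ k # bs"
    by (meson split_list)
  with Cons.prems have "mset ks = mset (as @ bs)"
    by simp
  with Cons.IH have "foldr partial ks f = foldr partial (as @ bs) f"
    by blast
  then show ?case
    unfolding ls foldr_partial_move[OF assms(1)] by simp
qed simp

text \<open>Spelling a multi-index as a list of directions reduces identities between iterated
  partials to equality of multisets.\<close>

definition mindex_list :: "nat ^ 'd::{finite,linorder} \<Rightarrow> 'd list" where
  "mindex_list s = concat (map (\<lambda>k. replicate (s $ k) k) (sorted_list_of_set UNIV))"

lemma mpartial_eq_foldr: "mpartial s f = foldr partial (mindex_list s) f"
proof -
  have "foldr partial (replicate n k) g = (partial k ^^ n) g" for n k and g :: "(real, 'a) vec \<Rightarrow> real"
    by (induction n) auto
  then have "foldr (\<lambda>k. partial k ^^ (s $ k)) ks f =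
      foldr partial (concat (map (\<lambda>k. replicate (s $ k) k) ks)) f" for ks
    by (induction ks) auto
  then show ?thesis
    by (simp add: mpartial_def mindex_list_def)
qed

lemma count_mindex_list: "count (mset (mindex_list s)) k = s $ k"
proof -
  have "count (mset (concat (map (\<lambda>j. replicate (s $ j) j) ks))) k = (if k \<in> set ks then s $ k else 0)"
    if "distinct ks" for ks
    using that by (induction ks) auto
  from this[of "sorted_list_of_set UNIV"] show ?thesis
    by (simp add: mindex_list_def)
qed

lemma mpartial_add:
  assumes "smooth f"
  shows "mpartial r (mpartial s f) = mpartial (r + s) f"
proof -
  have "mset (mindex_list r @ mindex_list s) = mset (mindex_list (r + s))"
    by (rule multiset_eqI) (simp add: count_mindex_list)
  from foldr_partial_cong_mset[OF assms this] show ?thesis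
    by (simp add: mpartial_eq_foldr)
qed

lemma partial_eq_mpartial:
  assumes "smooth f"
  shows "partial k f = mpartial (axis k 1) f"
proof -
  have "mset [k] = mset (mindex_list (axis k 1))"
    by (rule multiset_eqI) (auto simp: count_mindex_list axis_def)
  from foldr_partial_cong_mset[OF assms this] show ?thesis
    by (simp add: mpartial_eq_foldr)
qed

lemma smooth_mpartial: "smooth f \<Longrightarrow> smooth (mpartial s f)"
  by (simp add: mpartial_eq_foldr smooth_foldr_partial)

section \<open>Multi-index factorials and powers of the Laplacian\<close>

definition mfact :: "nat ^ 'd \<Rightarrow> real" where
  "mfact s = (\<Prod>k\<in>UNIV. fact (s $ k))"

lemma finite_msize_le [simp]: "finite {r :: nat ^ 'd. msize r \<le> M}"
proof (rule finite_subset)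
  show "{r :: nat ^ 'd. msize r \<le> M} \<subseteq> vec_lambda ` (Pi\<^sub>E UNIV (\<lambda>_. {..M}))"
  proof safe
    fix r :: "nat ^ 'd" assume "msize r \<le> M"
    then have "r $ k \<le> M" for k
      unfolding msize_def by (meson finite UNIV_I le_trans member_le_sum zero_le)
    then have "vec_nth r \<in> Pi\<^sub>E UNIV (\<lambda>_. {..M})"
      by auto
    then show "r \<in> vec_lambda ` (Pi\<^sub>E UNIV (\<lambda>_. {..M}))"
      by (metis image_eqI vec_nth_inverse)
  qed
qed (intro finite_imageI finite_PiE, auto)

lemma finite_msize_eq [simp]: "finite {r :: nat ^ 'd. msize r = M}"
  by (rule finite_subset[OF _ finite_msize_le[of M]]) auto

lemma msize_add: "msize (r + s) = msize r + msize s"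
  by (simp add: msize_def sum.distrib)

lemma msize_axis [simp]: "msize (axis k n) = n"
  by (simp add: msize_def axis_def)

lemma mfact_add_axis: "mfact (t + axis k 1) = of_nat (Suc (t $ k)) * mfact t"
proof -
  have "(\<Prod>j\<in>UNIV - {k}. fact ((t + axis k 1) $ j)) = (\<Prod>j\<in>UNIV - {k}. fact (t $ j) :: real)"
    by (intro prod.cong) (auto simp: axis_def)
  then show ?thesis
    by (simp add: mfact_def prod.remove[of UNIV k] axis_def mult_ac)
qed

lemma mfact_pos: "mfact s > 0"
  by (simp add: mfact_def prod_pos)

text \<open>The multinomial theorem for the commuting operators \<open>partial k\<close> squared,
  proved by induction on \<open>m\<close>.\<close>

lemma laplacian_power_eq_sum:
  fixes f :: "real ^ 'd::{finite,linorder} \<Rightarrow> real"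
  assumes "smooth f"
  shows "(laplacian ^^ m) f x = (\<Sum>t | msize t = m. fact m / mfact t * mpartial (t + t) f x)"
proof (induction m arbitrary: x)
  case 0
  have "{t :: (nat, 'd) vec. msize t = 0} = {0}"
    by (auto simp: msize_def vec_eq_iff)
  moreover have "mpartial 0 f = f"
  proof -
    have "mset (mindex_list 0) = mset ([] :: 'd list)"
      by (rule multiset_eqI) (simp add: count_mindex_list)
    then show ?thesis
      by (simp add: mpartial_eq_foldr)
  qed
  ultimately show ?case
    by (simp add: mfact_def)
next
  case (Suc m)
  define T where "T = (\<lambda>m. {t :: (nat, 'd) vec. msize t = m})"
  have fin: "finite (T m)" for m
    by (simp add: T_def)
  have smooth2: "smooth (mpartial (t + t) f)" for t
    by (intro smooth_mpartial assms)
  have pp: "partial k (partial k (mpartial (t + t) f)) = mpartial ((t + axis k 1) + (t + axis k 1)) f" for k t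
    using assms smooth2[of t]
    by (simp add: partial_eq_mpartial smooth_mpartial mpartial_add add_ac)
  have IH: "(laplacian ^^ m) f = (\<lambda>x. \<Sum>t\<in>T m. fact m / mfact t * mpartial (t + t) f x)"
    using Suc by (auto simp: T_def)
  have "(laplacian ^^ Suc m) f x = laplacian (\<lambda>x. \<Sum>t\<in>T m. fact m / mfact t * mpartial (t + t) f x) x"
    by (simp add: IH)
  also have "\<dots> = (\<Sum>k\<in>UNIV. \<Sum>t\<in>T m. fact m / mfact t * mpartial ((t + axis k 1) + (t + axis k 1)) f x)"
  proof -
    have p1: "partial k (\<lambda>x. \<Sum>t\<in>T m. fact m / mfact t * mpartial (t + t) f x) =
        (\<lambda>x. \<Sum>t\<in>T m. fact m / mfact t * partial k (mpartial (t + t) f) x)" for k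
      by (intro ext partial_sum_scaled smooth_imp_differentiable smooth2)
    have p2: "partial k (\<lambda>x. \<Sum>t\<in>T m. fact m / mfact t * partial k (mpartial (t + t) f) x) x =
        (\<Sum>t\<in>T m. fact m / mfact t * partial k (partial k (mpartial (t + t) f)) x)" for k
      by (intro partial_sum_scaled smooth_imp_differentiable smooth_partial smooth2)
    show ?thesis
      by (simp only: laplacian_def p1 p2 pp)
  qed
  \<comment> \<open>Substitute \<open>u = t + axis k 1\<close>, where \<open>1 / mfact t\<close>
    becomes \<open>u $ k / mfact u\<close>. The factor \<open>u $ k\<close> vanishes on every
    \<open>u\<close> not of this form, so the sum may range over all of
    \<open>T (Suc m)\<close>.\<close>
  also have "\<dots> = (\<Sum>k\<in>UNIV. \<Sum>u\<in>T (Suc m). fact m * real (u $ k) / mfact u * mpartial (u + u) f x)"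
  proof (rule sum.cong[OF refl])
    fix k :: 'd
    let ?g = "\<lambda>t. t + axis k 1 :: (nat, 'd) vec"
    have inj: "inj_on ?g (T m)"
      by (auto simp: inj_on_def)
    have zero: "u $ k = 0" if "u \<in> T (Suc m) - ?g ` T m" for u
    proof (rule ccontr)
      assume "u $ k \<noteq> 0"
      define v where "v = (\<chi> j. if j = k then u $ j - 1 else u $ j)"
      have u: "u = ?g v"
        using \<open>u $ k \<noteq> 0\<close> by (auto simp: v_def vec_eq_iff axis_def)
      then have "msize u = msize v + 1"
        by (simp add: msize_add)
      with that u show False
        by (auto simp: T_def)
    qed
    have "(\<Sum>u\<in>T (Suc m). fact m * real (u $ k) / mfact u * mpartial (u + u) f x) =
        (\<Sum>u\<in>?g ` T m. fact m * real (u $ k) / mfact u * mpartial (u + u) f x)"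
      by (rule sum.mono_neutral_right) (auto simp: fin zero T_def msize_add)
    also have "\<dots> = (\<Sum>t\<in>T m. fact m * real (?g t $ k) / mfact (?g t) * mpartial (?g t + ?g t) f x)"
      by (subst sum.reindex[OF inj]) (simp only: o_def)
    also have "\<dots> = (\<Sum>t\<in>T m. fact m / mfact t * mpartial (?g t + ?g t) f x)"
    proof (intro sum.cong refl arg_cong2[where f="(*)"])
      fix t
      have "?g t $ k = Suc (t $ k)"
        by (simp add: axis_def)
      then show "fact m * real (?g t $ k) / mfact (?g t) = fact m / mfact t"
        unfolding mfact_add_axis by (simp del: of_nat_Suc)
    qed
    finally show "(\<Sum>t\<in>T m. fact m / mfact t * mpartial (?g t + ?g t) f x) =
        (\<Sum>u\<in>T (Suc m). fact m * real (u $ k) / mfact u * mpartial (u + u) f x)"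
      by (rule sym)
  qed
  \<comment> \<open>After exchanging the sums, the entries \<open>u $ k\<close> add up to
    \<open>Suc m\<close>, which turns \<open>fact m\<close> into
    \<open>fact (Suc m)\<close>.\<close>
  also have "\<dots> = (\<Sum>u\<in>T (Suc m). fact (Suc m) / mfact u * mpartial (u + u) f x)"
  proof (subst sum.swap, intro sum.cong refl)
    fix u assume "u \<in> T (Suc m)"
    then have "(\<Sum>k\<in>UNIV. real (u $ k)) = real (Suc m)"
      by (simp add: T_def msize_def flip: of_nat_sum)
    moreover have "(\<Sum>k\<in>UNIV. fact m * real (u $ k) / mfact u * mpartial (u + u) f x) =
        fact m * (\<Sum>k\<in>UNIV. real (u $ k)) / mfact u * mpartial (u + u) f x"
      by (simp add: sum_distrib_left sum_distrib_right sum_divide_distrib)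
    ultimately show "(\<Sum>k\<in>UNIV. fact m * real (u $ k) / mfact u * mpartial (u + u) f x) =
        fact (Suc m) / mfact u * mpartial (u + u) f x"
      by (simp add: mult_ac)
  qed
  finally show ?case
    by (simp add: T_def)
qed

section \<open>Taylor expansion\<close>

text \<open>Tail terms have order at least \<open>M + 1\<close>, so for \<open>h\<close> at most
  \<open>1\<close> each is bounded by \<open>h ^ (M + 1)\<close> times its absolute value at
  \<open>h = 1\<close>; \<open>K\<close> is the sum of these values.\<close>

lemma taylor_tail_bound:
  fixes f :: "real ^ 'd::{finite,linorder} \<Rightarrow> real"
  assumes "taylor_converges_everywhere f"
  obtains K where "\<And>h. 0 < h \<Longrightarrow> h \<le> 1 \<Longrightarrow>
    \<bar>f (x + h *\<^sub>R v) - (\<Sum>r | msize r \<le> M. mpartial r f x / mfact r * h ^ msize r * (\<Prod>k\<in>UNIV. (v $ k) ^ (r $ k)))\<bar>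
      \<le> K * h ^ (M + 1)"
proof -
  define g where "g = (\<lambda>r. mpartial r f x / mfact r * (\<Prod>k\<in>UNIV. (v $ k) ^ (r $ k)))"
  define R :: "(nat ^ 'd::{finite,linorder}) set" where "R = {r. msize r \<le> M}"
  have fin: "finite R"
    by (simp add: R_def)
  have sum: "((\<lambda>r. g r * h ^ msize r) has_sum f (x + h *\<^sub>R v)) UNIV" for h
  proof -
    have "mpartial r f x / (\<Prod>k\<in>UNIV. fact (r $ k)) * (\<Prod>k\<in>UNIV. ((x + h *\<^sub>R v) $ k - x $ k) ^ (r $ k)) =
        g r * h ^ msize r" for r
      by (simp add: g_def mfact_def msize_def power_mult_distrib prod.distrib power_sum)
    moreover have "((\<lambda>r. mpartial r f x / (\<Prod>k\<in>UNIV. fact (r $ k)) *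
        (\<Prod>k\<in>UNIV. ((x + h *\<^sub>R v) $ k - x $ k) ^ (r $ k))) has_sum f (x + h *\<^sub>R v)) UNIV"
      using assms unfolding taylor_converges_everywhere_def by blast
    ultimately show ?thesis
      by simp
  qed
  have "g summable_on UNIV"
    using has_sum_imp_summable[OF sum[of 1]] by simp
  then have "g summable_on (- R)"
    by (rule summable_on_subset) simp
  \<comment> \<open>For real families unordered summability is absolute summability.\<close>
  then have "(\<lambda>r. \<bar>g r\<bar>) summable_on (- R)"
    using summable_on_iff_abs_summable_on_real[of g] by simp
  then obtain K where K: "((\<lambda>r. \<bar>g r\<bar>) has_sum K) (- R)"
    by (auto simp: summable_on_def)
  have "\<bar>f (x + h *\<^sub>R v) - (\<Sum>r\<in>R. g r * h ^ msize r)\<bar> \<le> K * h ^ (M + 1)"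
    if h: "0 < h" "h \<le> 1" for h
  proof -
    have "((\<lambda>r. g r * h ^ msize r) has_sum (f (x + h *\<^sub>R v) - (\<Sum>r\<in>R. g r * h ^ msize r))) (UNIV - R)"
      using fin by (intro has_sum_Diff sum has_sum_finite) auto
    moreover have "((\<lambda>r. \<bar>g r\<bar> * h ^ (M + 1)) has_sum (K * h ^ (M + 1))) (UNIV - R)"
      using has_sum_cmult_left[OF K] by (simp add: Compl_eq_Diff_UNIV)
    ultimately have "norm (f (x + h *\<^sub>R v) - (\<Sum>r\<in>R. g r * h ^ msize r)) \<le> K * h ^ (M + 1)"
    proof (rule norm_infsum_le)
      fix r assume "r \<in> UNIV - R"
      then have "h ^ msize r \<le> h ^ (M + 1)"
        using h by (intro power_decreasing) (auto simp: R_def)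
      then show "norm (g r * h ^ msize r) \<le> \<bar>g r\<bar> * h ^ (M + 1)"
        using h by (simp add: abs_mult mult_left_mono)
    qed
    then show ?thesis
      by simp
  qed
  then show ?thesis
    by (intro that[of K]) (simp add: R_def g_def mult_ac)
qed

text \<open>In each coordinate the falling factorial divides by \<open>fact (2 * t $ k)\<close>,
  which cancels the numerator of the even moment.\<close>

lemma prod_gauss_expect_hermite_even:
  fixes s t :: "nat ^ 'd::finite"
  shows "(\<Prod>k\<in>UNIV. gauss_expect (hermite_poly (s $ k) * monom 1 ((s + t + t) $ k))) =
    mfact (s + t + t) / (2 ^ msize t * mfact t)"
proof -
  have "gauss_expect (hermite_poly (s $ k) * monom 1 ((s + t + t) $ k)) =
      fact ((s + t + t) $ k) / (2 ^ (t $ k) * fact (t $ k))" for k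
    using gauss_moment_even[of "t $ k"] by (simp add: gauss_expect_hermite_monom mult_2 add.assoc)
  then show ?thesis
    by (simp add: prod_dividef prod.distrib mfact_def msize_def power_sum)
qed

text \<open>Each factor must be nonzero, which forces \<open>r $ k - s $ k\<close> to be nonnegative
  and even; \<open>t\<close> is half of it.\<close>

lemma prod_gauss_expect_hermite_nonzero:
  fixes s r :: "nat ^ 'd::finite"
  assumes "(\<Prod>k\<in>UNIV. gauss_expect (hermite_poly (s $ k) * monom 1 (r $ k))) \<noteq> 0"
  obtains t where "r = s + t + t"
proof -
  have "s $ k \<le> r $ k" "even (r $ k - s $ k)" for k
  proof -
    have "gauss_expect (hermite_poly (s $ k) * monom 1 (r $ k)) \<noteq> 0"
      using assms by auto
    then have "s $ k \<le> r $ k \<and> gauss_moment (r $ k - s $ k) \<noteq> 0"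
      by (auto simp: gauss_expect_hermite_monom split: if_splits)
    then show "s $ k \<le> r $ k" "even (r $ k - s $ k)"
      using gauss_moment_odd by blast+
  qed
  note r = this
  have "r = s + (\<chi> k. (r $ k - s $ k) div 2) + (\<chi> k. (r $ k - s $ k) div 2)"
  proof (rule vec_eq_iff[THEN iffD2], rule allI)
    fix k
    show "r $ k = (s + (\<chi> k. (r $ k - s $ k) div 2) + (\<chi> k. (r $ k - s $ k) div 2)) $ k"
      using r[of k] by (simp, presburger)
  qed
  then show ?thesis
    by (rule that)
qed

text \<open>On the truncated Taylor series the expansion is exact: every moment that enters is a
  Gaussian one.\<close>

lemma weighted_taylor_polynomial:
  fixes f :: "real ^ 'd::{finite,linorder} \<Rightarrow> real" and s :: "nat ^ 'd::{finite,linorder}"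
  assumes "a > 0" and "h > 0" and "smooth f"
    and inv: "invariant_weights \<Omega> w" and pres: "hermite_norm_preservation N a \<Omega> w"
    and "msize s \<le> N"
  shows "(a / h) ^ msize s * (\<Sum>i\<in>\<Omega>. w i * mhermite s (a *\<^sub>R real_vec i) *
      (\<Sum>r | msize r \<le> 2 * N + 1 - msize s.
        mpartial r f x / mfact r * h ^ msize r * (\<Prod>k\<in>UNIV. (real_vec i $ k) ^ (r $ k)))) =
    (\<Sum>m=0..N - msize s. 1 / (2 ^ m * fact m) * (h / a) ^ (2 * m) * (laplacian ^^ m) (mpartial s f) x)"
    (is "?L = ?R")
proof -
  \<comment> \<open>The largest truncation order for which \<open>msize s + msize r\<close> stays
    within the controlled range \<open>2 * N + 1\<close>.\<close>
  define M where "M = 2 * N + 1 - msize s"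
  define R :: "(nat ^ 'd::{finite,linorder}) set" where "R = {r. msize r \<le> M}"
  define T :: "(nat ^ 'd::{finite,linorder}) set" where "T = {t. msize t \<le> N - msize s}"
  define G where "G = (\<lambda>r. \<Prod>k\<in>UNIV. gauss_expect (hermite_poly (s $ k) * monom 1 (r $ k)))"
  define F where "F = (\<lambda>r. mpartial r f x / mfact r * ((a / h) ^ msize s * (h / a) ^ msize r) * G r)"
  define I where "I = (\<lambda>t. s + t + t)"
  have fin: "finite R" "finite T"
    by (simp_all add: R_def T_def)
  have G: "(\<Sum>i\<in>\<Omega>. w i * mhermite s (a *\<^sub>R real_vec i) * (\<Prod>k\<in>UNIV. (real_vec i $ k) ^ (r $ k))) =
      G r / a ^ msize r" if "r \<in> R" for r
  proof -
    have "msize s + msize r \<le> 2 * N + 1"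
      using that assms(6) by (simp add: R_def M_def)
    from weighted_hermite_moment[OF inv pres this]
    have "a ^ msize r * (\<Sum>i\<in>\<Omega>. w i * mhermite s (a *\<^sub>R real_vec i) * (\<Prod>k\<in>UNIV. (real_vec i $ k) ^ (r $ k))) = G r"
      by (simp add: G_def real_vec_def power_mult_distrib prod.distrib msize_def power_sum sum_distrib_left mult_ac)
    with assms(1) show ?thesis
      by (simp add: field_simps)
  qed
  have "?L = (\<Sum>r\<in>R. mpartial r f x / mfact r * ((a / h) ^ msize s * h ^ msize r) *
      (\<Sum>i\<in>\<Omega>. w i * mhermite s (a *\<^sub>R real_vec i) * (\<Prod>k\<in>UNIV. (real_vec i $ k) ^ (r $ k))))"
    unfolding R_def M_def sum_distrib_left by (subst sum.swap) (simp add: mult_ac)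
  also have "\<dots> = (\<Sum>r\<in>R. F r)"
    by (intro sum.cong refl) (simp add: G F_def power_divide)
  \<comment> \<open>Only \<open>r = s + t + t\<close> contributes. Then
    \<open>msize r \<le> M\<close> says \<open>2 * (msize s + msize t) \<le> 2 * N + 1\<close>,
    which by parity is the bound defining \<open>T\<close>.\<close>
  also have "\<dots> = (\<Sum>r\<in>I ` T. F r)"
  proof (rule sum.mono_neutral_right[OF fin(1)])
    show "I ` T \<subseteq> R"
      using assms(6) by (auto simp: I_def T_def R_def M_def msize_add)
    show "\<forall>r\<in>R - I ` T. F r = 0"
    proof (rule ballI, rule ccontr)
      fix r assume r: "r \<in> R - I ` T" "F r \<noteq> 0"
      then have "G r \<noteq> 0"
        by (auto simp: F_def)
      then obtain t where "r = s + t + t"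
        unfolding G_def by (rule prod_gauss_expect_hermite_nonzero)
      with r assms(6) show False
        by (auto simp: I_def T_def R_def M_def msize_add)
    qed
  qed
  also have "\<dots> = (\<Sum>t\<in>T. F (I t))"
  proof -
    have "inj_on I T"
    proof (rule inj_onI)
      fix t u assume "I t = I u"
      then have "t $ k + t $ k = u $ k + u $ k" for k
        by (simp add: I_def vec_eq_iff)
      then have "t $ k = u $ k" for k
        by (metis add_self_div_2)
      then show "t = u"
        by (simp add: vec_eq_iff)
    qed
    then show ?thesis
      by (simp add: sum.reindex)
  qed
  also have "\<dots> = (\<Sum>t\<in>T. (h / a) ^ (2 * msize t) / (2 ^ msize t * mfact t) * mpartial (t + t + s) f x)"
  proof (intro sum.cong refl)
    fix t
    have "(a / h) ^ msize s * (h / a) ^ msize s = 1"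
      using assms(1,2) by (simp flip: power_mult_distrib)
    then have "(a / h) ^ msize s * (h / a) ^ msize (I t) = (h / a) ^ (2 * msize t)"
      by (simp add: I_def msize_add power_add mult_2 flip: mult.assoc)
    moreover have "t + t + s = I t"
      by (simp add: I_def add_ac)
    moreover have "mfact (I t) \<noteq> 0"
      using mfact_pos[of "I t"] by simp
    moreover have "G (I t) = mfact (I t) / (2 ^ msize t * mfact t)"
      unfolding G_def I_def by (rule prod_gauss_expect_hermite_even)
    ultimately show "F (I t) = (h / a) ^ (2 * msize t) / (2 ^ msize t * mfact t) * mpartial (t + t + s) f x"
      by (simp add: F_def)
  qed
  \<comment> \<open>Grouping by \<open>m = msize t\<close> collects, up to
    \<open>1 / (2 ^ m * fact m)\<close>, the multinomial expansion of the \<open>m\<close>-th power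
    of the Laplacian.\<close>
  also have "\<dots> = (\<Sum>m=0..N - msize s. \<Sum>t | t \<in> T \<and> msize t = m.
      (h / a) ^ (2 * msize t) / (2 ^ msize t * mfact t) * mpartial (t + t + s) f x)"
    by (rule sum.group[symmetric]) (auto simp: fin T_def)
  also have "\<dots> = ?R"
  proof (intro sum.cong refl)
    fix m assume "m \<in> {0..N - msize s}"
    then have "{t. t \<in> T \<and> msize t = m} = {t. msize t = m}"
      by (auto simp: T_def)
    then show "(\<Sum>t | t \<in> T \<and> msize t = m.
        (h / a) ^ (2 * msize t) / (2 ^ msize t * mfact t) * mpartial (t + t + s) f x) =
      1 / (2 ^ m * fact m) * (h / a) ^ (2 * m) * (laplacian ^^ m) (mpartial s f) x"
      using assms(3)
      by (simp add: laplacian_power_eq_sum smooth_mpartial mpartial_add sum_distrib_left mult_ac)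
  qed
  finally show ?thesis .
qed

theorem mainTheorem1:
  fixes n N\<^sub>q :: nat and a :: real
    and \<Omega> :: "(int ^ 'd::{finite,linorder}) set" and w :: "int ^ 'd::{finite,linorder} \<Rightarrow> real"
    and f :: "real ^ 'd::{finite,linorder} \<Rightarrow> real" and x :: "real ^ 'd::{finite,linorder}" and s :: "nat ^ 'd::{finite,linorder}"
  assumes "n \<le> N\<^sub>q" and "a > 0"
    and "finite \<Omega>" and "invariant_weights \<Omega> w"
    and "hermite_norm_preservation N\<^sub>q a \<Omega> w"
    and "smooth f" and "taylor_converges_everywhere f"
    and "msize s = n"
  shows "(\<lambda>h. (a / h) ^ n *
              (\<Sum>i\<in>\<Omega>. w i * mhermite s (a *\<^sub>R real_vec i) * f (x + h *\<^sub>R real_vec i))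
            - (\<Sum>m=0..N\<^sub>q - n. 1 / (2 ^ m * fact m) * (h / a) ^ (2 * m) *
                 (laplacian ^^ m) (mpartial s f) x))
         \<in> O[at_right 0](\<lambda>h. h ^ (2 * (N\<^sub>q - n + 1)))"
proof -
  define M where "M = 2 * N\<^sub>q + 1 - n"
  define P where "P = (\<lambda>i h. \<Sum>r | msize r \<le> M.
    mpartial r f x / mfact r * h ^ msize r * (\<Prod>k\<in>UNIV. (real_vec i $ k) ^ (r $ k)))"
  define b where "b = (\<lambda>i. w i * mhermite s (a *\<^sub>R real_vec i))"
  have "\<exists>K. \<forall>h. 0 < h \<longrightarrow> h \<le> 1 \<longrightarrow> \<bar>f (x + h *\<^sub>R real_vec i) - P i h\<bar> \<le> K * h ^ (M + 1)" for i
    using taylor_tail_bound[OF assms(7), of x "real_vec i" M] unfolding P_def by blast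
  then obtain K where K: "\<And>i h. 0 < h \<Longrightarrow> h \<le> 1 \<Longrightarrow> \<bar>f (x + h *\<^sub>R real_vec i) - P i h\<bar> \<le> K i * h ^ (M + 1)"
    by metis
  \<comment> \<open>The remainders contribute \<open>K i * h ^ (M + 1)\<close> with weights
    \<open>b i\<close>; the prefactor supplies \<open>a ^ n\<close> and divides by
    \<open>h ^ n\<close>.\<close>
  define C where "C = a ^ n * (\<Sum>i\<in>\<Omega>. \<bar>b i\<bar> * K i)"
  have bound: "norm ((a / h) ^ n * (\<Sum>i\<in>\<Omega>. b i * f (x + h *\<^sub>R real_vec i))
      - (\<Sum>m=0..N\<^sub>q - n. 1 / (2 ^ m * fact m) * (h / a) ^ (2 * m) * (laplacian ^^ m) (mpartial s f) x))
      \<le> C * norm (h ^ (2 * (N\<^sub>q - n + 1)))" if h: "0 < h" "h < 1" for h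
  proof -
    \<comment> \<open>The claimed main part is exactly the weighted sum of Taylor polynomials, so
      only Taylor remainders are left in the difference.\<close>
    have "(\<Sum>m=0..N\<^sub>q - n. 1 / (2 ^ m * fact m) * (h / a) ^ (2 * m) * (laplacian ^^ m) (mpartial s f) x) =
        (a / h) ^ n * (\<Sum>i\<in>\<Omega>. b i * P i h)"
      using weighted_taylor_polynomial[OF assms(2) h(1) assms(6,4,5), of s x] assms(1,8)
      by (simp add: P_def M_def b_def)
    then have "norm ((a / h) ^ n * (\<Sum>i\<in>\<Omega>. b i * f (x + h *\<^sub>R real_vec i))
        - (\<Sum>m=0..N\<^sub>q - n. 1 / (2 ^ m * fact m) * (h / a) ^ (2 * m) * (laplacian ^^ m) (mpartial s f) x)) =
        \<bar>(a / h) ^ n * (\<Sum>i\<in>\<Omega>. b i * (f (x + h *\<^sub>R real_vec i) - P i h))\<bar>"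
      by (simp add: right_diff_distrib sum_subtractf)
    also have "\<dots> = (a / h) ^ n * \<bar>\<Sum>i\<in>\<Omega>. b i * (f (x + h *\<^sub>R real_vec i) - P i h)\<bar>"
      using assms(2) h by (simp add: abs_mult)
    also have "\<dots> \<le> (a / h) ^ n * (\<Sum>i\<in>\<Omega>. \<bar>b i\<bar> * (K i * h ^ (M + 1)))"
    proof (intro mult_left_mono order.trans[OF sum_abs] sum_mono)
      fix i
      show "\<bar>b i * (f (x + h *\<^sub>R real_vec i) - P i h)\<bar> \<le> \<bar>b i\<bar> * (K i * h ^ (M + 1))"
        unfolding abs_mult using h by (intro mult_left_mono K) auto
    qed (use assms(2) h in auto)
    also have "\<dots> = C * (h ^ (M + 1) / h ^ n)"
      by (simp add: C_def sum_distrib_left sum_distrib_right power_divide mult_ac)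
    also have "h ^ (M + 1) / h ^ n = h ^ (2 * (N\<^sub>q - n + 1))"
    proof -
      have "M + 1 = 2 * (N\<^sub>q - n + 1) + n"
        using assms(1) by (simp add: M_def)
      then show ?thesis
        using h by (simp only: power_add) simp
    qed
    finally show ?thesis
      using h by simp
  qed
  \<comment> \<open>The remainder bound holds for \<open>0 < h \<le> 1\<close>, and
    \<open>at_right 0\<close> eventually stays in this range.\<close>
  have "eventually (\<lambda>h. h \<in> {0<..<1::real}) (at_right 0)"
    by (rule eventually_at_right_real) simp
  then show ?thesis
    using bound unfolding b_def by (intro bigoI[of _ C]) (auto elim!: eventually_mono)
qed

end
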